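(* If $\mathcal{A}$ is a commutative unital locally $C^{\ast}$-algebra, with topology given by the upward filtered family $\{p_\alpha\}_{\alpha\in\Lambda}$ of $C^{\ast}$-seminorms, then the character space $\mathcal{M}_{\mathcal{A}}$ is in one to one correspondence with the set of maximal ideals of $\mathcal{A}$ that contain $\mathcal{I}_\alpha$ for some $\alpha\in\Lambda$.
   Context: A $C^{\ast}$-seminorm on a unital complex $\ast$-algebra $\mathcal{A}$ is a seminorm $p$ with $p(1)=1$, $p(ab)\le p(a)p(b)$, $p(a^{\ast})=p(a)$, $p(a^{\ast}a)=p(a)^2$. Let $(\Lambda,\le)$ be a directed partially ordered set. A family $\{p_\alpha\}_{\alpha\in\Lambda}$ is upward filtered if $p_\alpha(a)\le p_\beta(a)$ for all $a$ whenever $\alpha\le\beta$. $\mathcal{A}$ is a (unital) locally $C^{\ast}$-algebra if it has a complete Hausdorff locally convex topology induced by an upward filtered family $\{p_\alpha\}_{\alpha\in\Lambda}$ of $C^{\ast}$-seminorms. Put $\mathcal{I}_\alpha=\{a\in\mathcal{A}: p_\alpha(a)=0\}$, $\mathcal{A}_\alpha=\mathcal{A}/\mathcal{I}_\alpha$ (a $C^{\ast}$-algebra with norm $\|a+\mathcal{I}_\alpha\|=p_\alpha(a)$), and $\pi_\alpha:\mathcal{A}\to\mathcal{A}_\alpha$ the quotient map. $\mathcal{M}_{\mathcal{A}_\alpha}$ is the set of nonzero multiplicative linear functionals on $\mathcal{A}_\alpha$, and the character space is $\mathcal{M}_{\mathcal{A}}=\{\varphi_\alpha\circ\pi_\alpha:\alpha\in\Lambda,\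 \varphi_\alpha\in\mathcal{M}_{\mathcal{A}_\alpha}\}$, a set of multiplicative linear functionals on $\mathcal{A}$. *)

theory Defs
  imports Complex_Main "HOL-Algebra.Algebraic_Closure_Type"
begin

locale unital_star_algebra = vector_space scaleC
  for scaleC :: "complex \<Rightarrow> 'a::ring_1 \<Rightarrow> 'a" +
  fixes star :: "'a \<Rightarrow> 'a"
  assumes scale_mult_left: "scaleC c a * b = scaleC c (a * b)"
    and scale_mult_right: "a * scaleC c b = scaleC c (a * b)"
    and star_star: "star (star a) = a"
    and star_add: "star (a + b) = star a + star b"
    and star_scale: "star (scaleC c a) = scaleC (cnj c) (star a)"
    and star_mult: "star (a * b) = star b * star a"

text \<open>Nonnegativity of \<open>p\<close> follows from the triangle inequality and homogeneity.\<close>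

definition cstar_seminorm ::
    "(complex \<Rightarrow> 'a::ring_1 \<Rightarrow> 'a) \<Rightarrow> ('a \<Rightarrow> 'a) \<Rightarrow> ('a \<Rightarrow> real) \<Rightarrow> bool" where
  "cstar_seminorm scaleC star p \<longleftrightarrow>
     (\<forall>a b. p (a + b) \<le> p a + p b) \<and>
     (\<forall>c a. p (scaleC c a) = cmod c * p a) \<and>
     p 1 = 1 \<and>
     (\<forall>a b. p (a * b) \<le> p a * p b) \<and>
     (\<forall>a. p (star a) = p a) \<and>
     (\<forall>a. p (star a * a) = (p a)\<^sup>2)"

text \<open>
  The index set is the type \<open>'i\<close>. The topology is that of the type \<open>'a\<close>: the sort
  \<open>t2_space\<close> makes it Hausdorff, and \<open>uniformity_seminorms\<close> says that its uniform
  structure, hence also its topology, is the one induced by the seminorms.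
  Completeness refers to Cauchy filters, not just to Cauchy sequences.
\<close>

locale locally_cstar_algebra = unital_star_algebra scaleC star
  for scaleC :: "complex \<Rightarrow> 'a::{ring_1, uniform_space, t2_space} \<Rightarrow> 'a"
    and star :: "'a \<Rightarrow> 'a" +
  fixes p :: "'i::order \<Rightarrow> 'a \<Rightarrow> real"
  assumes directed: "\<exists>\<gamma>. \<alpha> \<le> \<gamma> \<and> \<beta> \<le> \<gamma>"
    and cstar_seminorm: "cstar_seminorm scaleC star (p \<alpha>)"
    and upward_filtered: "\<alpha> \<le> \<beta> \<Longrightarrow> p \<alpha> a \<le> p \<beta> a"
    and uniformity_seminorms:
      "uniformity = (INF \<alpha>. INF e\<in>{0<..}. principal {(x, y). p \<alpha> (x - y) < e})"
    and complete: "complete (UNIV :: 'a set)"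

definition null_ideal :: "('a \<Rightarrow> real) \<Rightarrow> 'a set" where
  "null_ideal q = {a. q a = 0}"

definition quotient_proj :: "'a::ring_1 set \<Rightarrow> 'a \<Rightarrow> 'a set" where
  "quotient_proj I a = I +>\<^bsub>ring_of_type_algebra\<^esub> a"

text \<open>
  \<open>ring_of_type_algebra Quot I\<close> carries only the ring structure of the quotient algebra.
  Its scalar multiplication is defined in the same way as \<open>rcoset_mult\<close>.
\<close>

definition quotient_scale ::
    "(complex \<Rightarrow> 'a::ring_1 \<Rightarrow> 'a) \<Rightarrow> 'a set \<Rightarrow> complex \<Rightarrow> 'a set \<Rightarrow> 'a set" where
  "quotient_scale scaleC I c A = (\<Union>x\<in>A. quotient_proj I (scaleC c x))"

text \<open>
  The nonzero multiplicative linear functionals on the quotient algebra by \<open>I\<close>. Outside the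
  set of cosets they take the value \<open>undefined\<close>, so that distinct elements of this set are
  distinct functionals.
\<close>

definition quotient_characters ::
    "(complex \<Rightarrow> 'a::ring_1 \<Rightarrow> 'a) \<Rightarrow> 'a set \<Rightarrow> ('a set \<Rightarrow> complex) set" where
  "quotient_characters scaleC I =
     (let Q = ring_of_type_algebra Quot I in
      {\<phi> \<in> extensional (carrier Q).
         (\<forall>A\<in>carrier Q. \<forall>B\<in>carrier Q. \<phi> (A \<oplus>\<^bsub>Q\<^esub> B) = \<phi> A + \<phi> B) \<and>
         (\<forall>c. \<forall>A\<in>carrier Q. \<phi> (quotient_scale scaleC I c A) = c * \<phi> A) \<and>
         (\<forall>A\<in>carrier Q. \<forall>B\<in>carrier Q. \<phi> (A \<otimes>\<^bsub>Q\<^esub> B) = \<phi> A * \<phi> B) \<and>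
         (\<exists>A\<in>carrier Q. \<phi> A \<noteq> 0)})"

definition character_space ::
    "(complex \<Rightarrow> 'a::ring_1 \<Rightarrow> 'a) \<Rightarrow> ('i \<Rightarrow> 'a \<Rightarrow> real) \<Rightarrow> ('a \<Rightarrow> complex) set" where
  "character_space scaleC p =
     {\<phi> \<circ> quotient_proj (null_ideal (p \<alpha>)) | \<alpha> \<phi>.
        \<phi> \<in> quotient_characters scaleC (null_ideal (p \<alpha>))}"

end

theory Submission
  imports Defs "HOL-Analysis.Topology_Euclidean_Space"
begin

text \<open>
  That kernels of characters are maximal ideals and determine the character is elementary.
  Conversely, let \<open>J\<close> be a maximal ideal containing the null ideal of \<open>p \<alpha>\<close>. The field \<open>A / J\<close>
  carries the quotient of \<open>p \<alpha>\<close>, and by Gelfand--Mazur it consists of scalars, provided this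
  quotient seminorm does not vanish, i.e. \<open>1\<close> is at positive distance from \<open>J\<close>. For this it
  suffices to invert \<open>1 - h\<close> modulo \<open>p \<alpha>\<close> whenever \<open>h\<close> is self-adjoint and \<open>p \<alpha> h\<close> is small.
  The Neumann series of \<open>h\<close> need not converge for the other seminorms, so \<open>h\<close> is first
  replaced by an element that agrees with it modulo \<open>p \<alpha>\<close> and is small for all seminorms:
  \<open>sin h\<close> is bounded by \<open>1\<close> in every \<open>p \<beta>\<close>, because \<open>exp (\<i> h)\<close> is unitary, and it is close to
  \<open>h\<close> for \<open>p \<alpha>\<close>, so rescaling and iterating gives the replacement. This also avoids proving
  that the quotients of \<open>A\<close> by the null ideals are complete.
\<close>

no_notation vec_lambda (binder "\<chi>" 10)

section \<open>The Gelfand--Mazur theorem modulo an ideal\<close>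

text \<open>Multiplying \<open>\<mu>\<close> by such a root changes the sign of
  \<open>\<mu> ^ (2 ^ m)\<close>, which turns a sum of two \<open>2 ^ m\<close>-th powers into a
  difference of \<open>2 ^ m\<close>-th powers.\<close>

lemma ex_root_minus_one: "\<exists>\<zeta>::complex. \<zeta> ^ (2 ^ m) = - 1"
proof
  show "cis (pi / 2 ^ m) ^ (2 ^ m) = - 1"
    unfolding DeMoivre by simp
qed

text \<open>The field meant is the quotient by \<open>J\<close>, but every equation is stated as a
  congruence modulo \<open>J\<close>. Since \<open>q\<close> vanishes on \<open>J\<close>, it
  descends to that quotient; together with \<open>q_one_pos\<close> this keeps \<open>1\<close> out
  of \<open>J\<close>.\<close>

locale seminormed_residue_field =
  fixes e :: "complex \<Rightarrow> 'a::comm_ring_1"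
    and J :: "'a set"
    and q :: "'a \<Rightarrow> real"
  assumes e_one: "e 1 = 1"
    and e_add: "e (c + d) = e c + e d"
    and e_mult: "e (c * d) = e c * e d"
    and J_add: "x \<in> J \<Longrightarrow> y \<in> J \<Longrightarrow> x + y \<in> J"
    and J_mult: "x \<in> J \<Longrightarrow> r * x \<in> J"
    and J_inverse: "x \<notin> J \<Longrightarrow> \<exists>y. x * y - 1 \<in> J"
    and q_add: "q (x + y) \<le> q x + q y"
    and q_mult: "q (x * y) \<le> q x * q y"
    and q_scale: "q (e c * x) = cmod c * q x"
    and q_J: "x \<in> J \<Longrightarrow> q x = 0"
    and q_one_pos: "0 < q 1"
    and q_one_le: "q 1 \<le> 1"
begin

section \<open>Congruences modulo \<open>J\<close> and rules for the seminorm\<close>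

lemma J_minus: "x \<in> J \<Longrightarrow> - x \<in> J"
  using J_mult[of x "- 1"] by simp

lemma J_diff: "x \<in> J \<Longrightarrow> y \<in> J \<Longrightarrow> x - y \<in> J"
  using J_add[of x "- y"] J_minus[of y] by simp

lemma e_zero: "e 0 = 0"
  using e_add[of 0 0] by simp

lemma e_minus: "e (- c) = - e c"
  using e_add[of c "- c"] by (simp add: e_zero add_eq_0_iff)

lemma e_diff: "e (c - d) = e c - e d"
  using e_add[of c "- d"] by (simp add: e_minus)

lemma e_power: "e (c ^ n) = e c ^ n"
  by (induction n) (simp_all add: e_one e_mult)

lemma q_zero: "q 0 = 0"
  using q_scale[of 0 0] by simp

lemma q_minus: "q (- x) = q x"
  using q_scale[of "- 1" x] by (simp add: e_minus e_one)

lemma q_diff: "q (x - y) \<le> q x + q y"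
  using q_add[of x "- y"] by (simp add: q_minus)

lemma q_nonneg: "0 \<le> q x"
  using q_add[of x "- x"] by (simp add: q_minus q_zero)

lemma q_cong: "x - y \<in> J \<Longrightarrow> q x = q y"
  using q_add[of "x - y" y] q_diff[of x "x - y"] by (simp add: q_J)

lemma q_power: "q (x ^ n) \<le> q x ^ n"
proof (induction n)
  case (Suc n)
  have "q (x ^ Suc n) \<le> q x * q (x ^ n)"
    by (simp add: q_mult)
  also have "\<dots> \<le> q x * q x ^ n"
    using Suc by (simp add: mult_left_mono q_nonneg)
  finally show ?case by simp
qed (simp add: q_one_le)

text \<open>With \<open>q_cong\<close>, the value of \<open>q\<close> at an inverse modulo
  \<open>J\<close> depends only on the element that is inverted.\<close>

lemma inverse_cong:
  assumes "x * y - 1 \<in> J" "x * z - 1 \<in> J"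
  shows "y - z \<in> J"
proof -
  have "y - z = y * - (x * z - 1) + z * (x * y - 1)"
    by (simp add: algebra_simps)
  then show ?thesis
    using J_add[OF J_mult[OF J_minus[OF assms(2)]] J_mult[OF assms(1)]] by simp
qed

text \<open>A difference of \<open>2 * N\<close>-th powers is the product of the difference and the
  sum of the \<open>N\<close>-th powers. The sum is the difference belonging to
  \<open>\<zeta> * \<mu>\<close>, so the induction hypothesis inverts both factors.\<close>

lemma ex_inverse_power:
  assumes "\<And>\<mu>. \<exists>r. (b - e \<mu>) * r - 1 \<in> J"
  shows "\<exists>v. (b ^ (2 ^ m) - e \<mu> ^ (2 ^ m)) * v - 1 \<in> J"
proof (induction m arbitrary: \<mu>)
  case 0
  then show ?case using assms by simp
next
  case (Suc m)
  define N :: nat where "N = 2 ^ m"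
  obtain \<zeta> :: complex where \<zeta>: "\<zeta> ^ N = - 1"
    using ex_root_minus_one unfolding N_def by blast
  obtain u where u: "(b ^ N - e \<mu> ^ N) * u - 1 \<in> J"
    using Suc unfolding N_def by blast
  obtain w where "(b ^ N - e (\<zeta> * \<mu>) ^ N) * w - 1 \<in> J"
    using Suc unfolding N_def by blast
  then have w: "(b ^ N + e \<mu> ^ N) * w - 1 \<in> J"
    by (simp add: e_power[symmetric] power_mult_distrib \<zeta> e_minus)
  have "(b ^ (N * 2) - e \<mu> ^ (N * 2)) * (u * w) - 1 =
      (b ^ N + e \<mu> ^ N) * w * ((b ^ N - e \<mu> ^ N) * u - 1) + ((b ^ N + e \<mu> ^ N) * w - 1)"
    by (simp add: power_mult power2_eq_square algebra_simps)
  then have "(b ^ (N * 2) - e \<mu> ^ (N * 2)) * (u * w) - 1 \<in> J"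
    using J_add[OF J_mult[OF u] w] by (simp only:)
  then show ?case unfolding N_def by (auto simp: mult.commute)
qed

text \<open>
  Modulo \<open>J\<close>, the element \<open>b ^ (N - 1) / (b ^ N - \<mu> ^ N)\<close> is the mean of \<open>1 / (b - \<omega> \<mu>)\<close> over the
  \<open>N\<close>-th roots of unity \<open>\<omega>\<close>. All terms are bounded by \<open>M\<close>, and the one for \<open>\<omega> = 1\<close> by \<open>q r\<close>.
  Taking \<open>N\<close> to be a power of two, only partial fractions with two terms are needed.
\<close>

lemma mean_bound:
  assumes ex: "\<And>\<mu>. \<exists>r. (b - e \<mu>) * r - 1 \<in> J"
    and M: "\<And>\<mu> r. (b - e \<mu>) * r - 1 \<in> J \<Longrightarrow> q r \<le> M"
    and v: "(b ^ (2 ^ m) - e \<mu> ^ (2 ^ m)) * v - 1 \<in> J"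
    and r: "(b - e \<mu>) * r - 1 \<in> J"
  shows "q (b ^ (2 ^ m - 1) * v) \<le> M - (M - q r) / 2 ^ m"
  using v r
proof (induction m arbitrary: \<mu> v r)
  case 0
  then show ?case using q_cong[OF inverse_cong, of "b - e \<mu>" v r] by simp
next
  case (Suc m)
  define N :: nat where "N = 2 ^ m"
  obtain \<zeta> :: complex where \<zeta>: "\<zeta> ^ N = - 1"
    using ex_root_minus_one unfolding N_def by blast
  have e_root: "e (\<zeta> * \<mu>) ^ N = - (e \<mu> ^ N)"
    by (simp add: e_power[symmetric] power_mult_distrib \<zeta> e_minus)
  \<comment> \<open>Modulo \<open>J\<close>, \<open>u\<close> and \<open>w\<close> invert
    \<open>b ^ N - e \<mu> ^ N\<close> and \<open>b ^ N + e \<mu> ^ N\<close>. Their sum is twice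
    \<open>b ^ N * v\<close>, the partial fraction with two terms.\<close>
  define u where "u = (b ^ N + e \<mu> ^ N) * v"
  define w where "w = (b ^ N - e \<mu> ^ N) * v"
  have v: "(b ^ N - e \<mu> ^ N) * (b ^ N + e \<mu> ^ N) * v - 1 \<in> J"
    using Suc.prems(1) by (simp add: N_def[symmetric] power_mult power2_eq_square algebra_simps)
  then have "(b ^ N - e \<mu> ^ N) * u - 1 \<in> J"
    by (simp add: u_def mult.assoc)
  then have qu: "q (b ^ (N - 1) * u) \<le> M - (M - q r) / 2 ^ m"
    using Suc.IH Suc.prems(2) unfolding N_def by blast
  obtain r' where r': "(b - e (\<zeta> * \<mu>)) * r' - 1 \<in> J"
    using ex by blast
  have "(b ^ N - e (\<zeta> * \<mu>) ^ N) * w - 1 \<in> J"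
    using v unfolding e_root w_def by (simp add: mult_ac)
  then have "q (b ^ (N - 1) * w) \<le> M - (M - q r') / 2 ^ m"
    using Suc.IH r' unfolding N_def by blast
  \<comment> \<open>Only the branch through \<open>\<mu>\<close> itself keeps the deficit
    \<open>M - q r\<close>; the other one is estimated by \<open>M\<close>, so each doubling of
    \<open>N\<close> halves the deficit.\<close>
  also have "\<dots> \<le> M" using M[OF r'] by simp
  finally have qw: "q (b ^ (N - 1) * w) \<le> M" .
  have N: "2 * N - 1 = (N - 1) + N" by (simp add: N_def)
  have "b ^ (N - 1) * u + b ^ (N - 1) * w = e 2 * (b ^ (2 * N - 1) * v)"
    using e_add[of 1 1] unfolding u_def w_def N power_add by (simp add: e_one algebra_simps)
  then have "2 * q (b ^ (2 * N - 1) * v) = q (b ^ (N - 1) * u + b ^ (N - 1) * w)"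
    by (simp add: q_scale)
  also have "\<dots> \<le> (M - (M - q r) / 2 ^ m) + M"
    using q_add[of "b ^ (N - 1) * u" "b ^ (N - 1) * w"] qu qw by linarith
  finally show ?case by (simp add: N_def field_simps)
qed

text \<open>A maximum principle: where the resolvent norm attains its maximum
  \<open>M = q d\<close>, it is constant nearby. A deficit at \<open>\<mu>\<close> would lower the
  mean by \<open>(M - q r) / N\<close>, whereas the mean differs from \<open>d\<close> only by a
  factor within \<open>2 ^ - N\<close> of \<open>1\<close>. Hence the deficit is at most
  \<open>M * N / 2 ^ N\<close> for all powers of two \<open>N\<close>.\<close>

lemma resolvent_norm_locally_constant:
  assumes ex: "\<And>\<mu>. \<exists>r. (b - e \<mu>) * r - 1 \<in> J"
    and M: "\<And>\<mu> r. (b - e \<mu>) * r - 1 \<in> J \<Longrightarrow> q r \<le> q d"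
    and d: "b * d - 1 \<in> J"
    and r: "(b - e \<mu>) * r - 1 \<in> J"
    and \<mu>: "cmod \<mu> * q d \<le> 1 / 2"
  shows "q r = q d"
proof -
  define M where "M = q d"
  have rM: "q r \<le> M" using M[OF r] by (simp add: M_def)
  have bound: "M - q r \<le> M * (real (2 ^ m) * (1 / 2) ^ (2 ^ m))" for m
  proof -
    define N :: nat where "N = 2 ^ m"
    have Npos: "0 < N" by (simp add: N_def)
    obtain v where v: "(b ^ N - e \<mu> ^ N) * v - 1 \<in> J"
      using ex_inverse_power[OF ex] unfolding N_def by blast
    \<comment> \<open>Modulo \<open>J\<close>, \<open>d\<close> is the inverse of \<open>b\<close>,
      so \<open>b ^ (N - 1) * v\<close> equals \<open>d / (1 - (\<mu> d) ^ N)\<close> and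
      \<open>P\<close> is another representative of \<open>d\<close>.\<close>
    define P where "P = b ^ (N - 1) * v * (1 - (e \<mu> * d) ^ N)"
    have qP: "q (b ^ (N - 1) * v) \<le> M - (M - q r) / N"
      using mean_bound[OF ex M v[unfolded N_def] r] unfolding N_def M_def by simp
    have s: "(b * d) ^ N - 1 \<in> J"
      unfolding power_diff_1_eq mult.commute[of "b * d - 1"] by (rule J_mult[OF d])
    have bN: "b * b ^ (N - 1) = b ^ N"
      using Npos by (simp add: power_eq_if)
    have "b * d * P = d * v * (b * b ^ (N - 1)) * (1 - (e \<mu> * d) ^ N)"
      unfolding P_def by (simp add: mult_ac)
    then have "b * d * P = d * v * b ^ N * (1 - (e \<mu> * d) ^ N)"
      unfolding bN .
    then have "d - P = P * (b * d - 1) - d * ((b ^ N - e \<mu> ^ N) * v - 1)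
        + d * v * e \<mu> ^ N * ((b * d) ^ N - 1)"
      by (simp add: power_mult_distrib algebra_simps)
    then have "d - P \<in> J"
      using J_add[OF J_diff[OF J_mult[OF d] J_mult[OF v]] J_mult[OF s]] by (simp only:)
    then have "M = q P" unfolding M_def by (rule q_cong)
    also have "\<dots> \<le> q (b ^ (N - 1) * v) * q (1 - (e \<mu> * d) ^ N)"
      unfolding P_def by (rule q_mult)
    also have "\<dots> \<le> (M - (M - q r) / N) * (1 + (1 / 2) ^ N)"
    proof (intro mult_mono qP)
      have "q ((e \<mu> * d) ^ N) \<le> (cmod \<mu> * q d) ^ N"
        using q_power[of "e \<mu> * d" N] by (simp add: q_scale)
      also have "\<dots> \<le> (1 / 2) ^ N"
        using \<mu> by (intro power_mono) (auto simp: q_nonneg)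
      finally show "q (1 - (e \<mu> * d) ^ N) \<le> 1 + (1 / 2) ^ N"
        using q_diff[of 1 "(e \<mu> * d) ^ N"] q_one_le by simp
      show "0 \<le> M - (M - q r) / N"
        using qP q_nonneg order_trans by blast
    qed (rule q_nonneg)
    also have "\<dots> \<le> M - (M - q r) / N + M * (1 / 2) ^ N"
    proof -
      have "(M - (M - q r) / N) * (1 / 2) ^ N \<le> M * (1 / 2) ^ N"
        using rM by (intro mult_right_mono) auto
      then show ?thesis by (simp add: distrib_left)
    qed
    finally have "(M - q r) / N \<le> M * (1 / 2) ^ N" by simp
    then show ?thesis
      using Npos unfolding N_def[symmetric] by (simp add: pos_divide_le_eq mult_ac)
  qed
  \<comment> \<open>The exponents are powers of two, so the limit of \<open>n / 2 ^ n\<close> is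
    taken along a subsequence.\<close>
  have "strict_mono (\<lambda>m. 2 ^ m :: nat)"
    by (simp add: strict_mono_def)
  moreover have "(\<lambda>n. real n * (1 / 2) ^ n) \<longlonglongrightarrow> 0"
    by (rule powser_times_n_limit_0) simp
  ultimately have "(\<lambda>m. real (2 ^ m) * (1 / 2) ^ (2 ^ m)) \<longlonglongrightarrow> 0"
    using LIMSEQ_subseq_LIMSEQ unfolding comp_def by blast
  then have "(\<lambda>m. M * (real (2 ^ m) * (1 / 2) ^ (2 ^ m))) \<longlonglongrightarrow> M * 0"
    by (intro tendsto_mult tendsto_const)
  then have "M - q r \<le> M * 0"
    using LIMSEQ_le_const bound by blast
  then show ?thesis using rM by (simp add: M_def)
qed

text \<open>If no scalar is congruent to \<open>a\<close>, the resolvent norm \<open>\<rho>\<close>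
  is defined on the whole plane, continuous, positive and small far from the origin, so it has a
  maximum \<open>M\<close>. Local constancy carries the value \<open>M\<close> along a ray in steps
  of fixed length, which contradicts the decay.\<close>

theorem gelfand_mazur: "\<exists>c. a - e c \<in> J"
proof (rule ccontr)
  assume "\<nexists>c. a - e c \<in> J"
  then have "\<forall>c. \<exists>y. (a - e c) * y - 1 \<in> J"
    using J_inverse by blast
  then obtain R where R: "(a - e c) * R c - 1 \<in> J" for c
    by metis
  define \<rho> where "\<rho> c = q (R c)" for c
  have \<rho>_pos: "0 < \<rho> c" for c
  proof -
    have "q 1 \<le> q (a - e c) * \<rho> c"
      using q_mult[of "a - e c" "R c"] q_cong[OF R[of c]] by (simp add: \<rho>_def)
    then show ?thesis
      using q_one_pos q_nonneg[of "R c"] by (cases "\<rho> c = 0") (auto simp: \<rho>_def)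
  qed
  \<comment> \<open>Dividing the resolvent identity \<open>R c - R d = (c - d) * R c * R d\<close>,
    valid modulo \<open>J\<close>, by \<open>\<rho> c * \<rho> d\<close> gives a Lipschitz constant
    that does not depend on the points.\<close>
  have lipschitz: "1 / \<rho> d - 1 / \<rho> c \<le> cmod (c - d)" for c d
  proof -
    have "R c - (e (c - d) * (R c * R d) + R d) =
        - (R c * ((a - e d) * R d - 1)) + R d * ((a - e c) * R c - 1)"
      by (simp add: e_diff algebra_simps)
    then have "q (R c) = q (e (c - d) * (R c * R d) + R d)"
      by (intro q_cong) (simp only: J_add[OF J_minus[OF J_mult[OF R]] J_mult[OF R]])
    also have "\<dots> \<le> cmod (c - d) * q (R c * R d) + q (R d)"
      using q_add[of "e (c - d) * (R c * R d)" "R d"] by (simp add: q_scale)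
    also have "\<dots> \<le> cmod (c - d) * (\<rho> c * \<rho> d) + \<rho> d"
      unfolding \<rho>_def by (intro add_mono mult_left_mono q_mult) auto
    finally have "\<rho> c \<le> cmod (c - d) * (\<rho> c * \<rho> d) + \<rho> d"
      unfolding \<rho>_def .
    then have "(\<rho> c - \<rho> d) / (\<rho> c * \<rho> d) \<le> cmod (c - d)"
      using \<rho>_pos[of c] \<rho>_pos[of d] by (simp add: pos_divide_le_eq)
    moreover have "(\<rho> c - \<rho> d) / (\<rho> c * \<rho> d) = 1 / \<rho> d - 1 / \<rho> c"
      using \<rho>_pos[of c] \<rho>_pos[of d] by (simp add: diff_divide_distrib)
    ultimately show ?thesis by simp
  qed
  have growth: "cmod c - q a \<le> 1 / \<rho> c" for c
  proof -
    have "(a * R c - e c * R c) - 1 \<in> J"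
      using R[of c] by (simp add: algebra_simps)
    then have "q (a * R c - e c * R c) \<le> 1"
      using q_cong[of "a * R c - e c * R c" 1] q_one_le by simp
    then have "q (e c * R c) \<le> q a * \<rho> c + 1"
      using q_diff[of "a * R c" "a * R c - e c * R c"] q_mult[of a "R c"] by (simp add: \<rho>_def)
    then have "cmod c * \<rho> c \<le> q a * \<rho> c + 1"
      by (simp add: q_scale \<rho>_def)
    then have "(cmod c - q a) * \<rho> c \<le> 1"
      by (simp add: left_diff_distrib)
    then show ?thesis
      using \<rho>_pos[of c] by (simp add: pos_le_divide_eq)
  qed
  have cont: "continuous_on A (\<lambda>c. 1 / \<rho> c)" for A
    unfolding continuous_on_iff
  proof (intro ballI allI impI exI conjI)
    fix c d :: complex and \<epsilon> :: real
    assume "0 < \<epsilon>" "dist d c < \<epsilon>"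
    then show "dist (1 / \<rho> d) (1 / \<rho> c) < \<epsilon>"
      using lipschitz[of c d] lipschitz[of d c] by (simp add: dist_norm norm_minus_commute)
  qed
  \<comment> \<open>Outside the ball of radius \<open>B\<close>, \<open>growth\<close> pushes
    \<open>1 / \<rho>\<close> above its value at \<open>0\<close>, so a minimum over the ball is
    global.\<close>
  define B where "B = 1 / \<rho> 0 + q a"
  have B: "0 \<le> B" using \<rho>_pos[of 0] q_nonneg[of a] by (simp add: B_def)
  then obtain c0 where c0: "c0 \<in> cball 0 B" "\<forall>c\<in>cball 0 B. 1 / \<rho> c0 \<le> 1 / \<rho> c"
    using continuous_attains_inf[OF compact_cball _ cont, of 0 B] by auto
  have min: "1 / \<rho> c0 \<le> 1 / \<rho> c" for c
  proof (cases "c \<in> cball 0 B")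
    case False
    then have "1 / \<rho> 0 < 1 / \<rho> c" using growth[of c] by (simp add: B_def)
    moreover have "1 / \<rho> c0 \<le> 1 / \<rho> 0" using c0(2) B by auto
    ultimately show ?thesis by simp
  qed (use c0 in blast)
  have max: "\<rho> c \<le> \<rho> c0" for c
    using min[of c] \<rho>_pos[of c] \<rho>_pos[of c0] by (simp add: field_simps)
  define M where "M = \<rho> c0"
  have M: "0 < M" using \<rho>_pos by (simp add: M_def)
  \<comment> \<open>The step length depends on \<open>M\<close> alone, so the argument repeats from
    each point that is reached.\<close>
  have step: "\<rho> (c + of_real (1 / (2 * M))) = M" if c: "\<rho> c = M" for c
  proof -
    have shift: "a - e c - e \<mu> = a - e (c + \<mu>)" for \<mu>
      by (simp add: e_add)
    show ?thesis
      unfolding \<rho>_def c[symmetric]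
    proof (rule resolvent_norm_locally_constant)
      show "\<exists>r. (a - e c - e \<mu>) * r - 1 \<in> J" for \<mu>
        unfolding shift using R by blast
      show "q r \<le> q (R c)" if "(a - e c - e \<mu>) * r - 1 \<in> J" for \<mu> r
        using q_cong[OF inverse_cong[OF that[unfolded shift] R]] max[of "c + \<mu>"] c
        by (simp add: \<rho>_def M_def)
      show "(a - e c) * R c - 1 \<in> J" by (rule R)
      show "(a - e c - e (of_real (1 / (2 * q (R c))))) * R (c + of_real (1 / (2 * q (R c)))) - 1 \<in> J"
        unfolding shift by (rule R)
      show "cmod (of_real (1 / (2 * q (R c)))) * q (R c) \<le> 1 / 2"
        using \<rho>_pos[of c] by (simp add: \<rho>_def norm_divide norm_mult)
    qed
  qed
  have const: "\<rho> (c0 + of_real (real n / (2 * M))) = M" for n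
  proof (induction n)
    case (Suc n)
    have "c0 + of_real (real (Suc n) / (2 * M)) = c0 + of_real (real n / (2 * M)) + of_real (1 / (2 * M))"
      by (simp add: add_divide_distrib)
    then show ?case using step[OF Suc] by metis
  qed (simp add: M_def)
  \<comment> \<open>So many steps lead to a point where \<open>growth\<close> forces
    \<open>1 / \<rho>\<close> above \<open>1 / M\<close>.\<close>
  obtain n where n: "(cmod c0 + q a + 1 / M) * (2 * M) < real n"
    using reals_Archimedean2 by blast
  have "real n / (2 * M) \<le> cmod (c0 + of_real (real n / (2 * M))) + cmod c0"
    using norm_triangle_ineq4[of "c0 + of_real (real n / (2 * M))" c0] M
    by (simp add: norm_divide norm_mult)
  also have "cmod (c0 + of_real (real n / (2 * M))) \<le> q a + 1 / M"
    using growth[of "c0 + of_real (real n / (2 * M))"] unfolding const by simp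
  finally have "real n / (2 * M) \<le> cmod c0 + q a + 1 / M" by simp
  then show False
    using n M by (simp only: pos_divide_le_eq)
qed

end

section \<open>Uniformly bounded representatives\<close>

locale comm_locally_cstar_algebra = locally_cstar_algebra scaleC star p
  for scaleC :: "complex \<Rightarrow> 'a::{comm_ring_1, uniform_space, t2_space} \<Rightarrow> 'a"
    and star :: "'a \<Rightarrow> 'a"
    and p :: "'i::order \<Rightarrow> 'a \<Rightarrow> real"
begin

section \<open>Calculus of scalars, involution and seminorms\<close>

definition emb :: "complex \<Rightarrow> 'a" where
  "emb c = scaleC c 1"

text \<open>Scalar multiplication becomes ring multiplication, the form in which
  \<open>seminormed_residue_field\<close> expects its scalars.\<close>

lemma scale_emb: "scaleC c x = emb c * x"
  using scale_mult_left[of c 1 x] by (simp add: emb_def)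

lemma emb_0 [simp]: "emb 0 = 0"
  and emb_1 [simp]: "emb 1 = 1"
  and emb_add: "emb (c + d) = emb c + emb d"
  and emb_diff: "emb (c - d) = emb c - emb d"
  and emb_minus: "emb (- c) = - emb c"
  by (simp_all add: emb_def scale_left_distrib scale_left_diff_distrib)

lemma emb_mult: "emb (c * d) = emb c * emb d"
  by (metis emb_def scale_emb scale_scale)

lemma star_one: "star 1 = 1"
  by (metis mult.right_neutral star_mult star_star)

lemma star_zero: "star 0 = 0"
  using star_add[of 0 0] by simp

lemma star_minus: "star (- x) = - star x"
  using star_add[of x "- x"] by (simp add: star_zero add_eq_0_iff)

lemma star_diff: "star (x - y) = star x - star y"
  using star_add[of x "- y"] by (simp add: star_minus)

lemma star_emb: "star (emb c) = emb (cnj c)"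
  by (simp add: emb_def star_scale star_one)

lemma p_add: "p \<beta> (x + y) \<le> p \<beta> x + p \<beta> y"
  and p_scale: "p \<beta> (scaleC c x) = cmod c * p \<beta> x"
  and p_one: "p \<beta> 1 = 1"
  and p_mult: "p \<beta> (x * y) \<le> p \<beta> x * p \<beta> y"
  and p_star: "p \<beta> (star x) = p \<beta> x"
  and p_cstar: "p \<beta> (star x * x) = (p \<beta> x)\<^sup>2"
  using cstar_seminorm[of \<beta>] by (auto simp: cstar_seminorm_def)

lemma p_emb_mult: "p \<beta> (emb c * x) = cmod c * p \<beta> x"
  using p_scale by (simp add: scale_emb)

lemma p_zero: "p \<beta> 0 = 0"
  using p_emb_mult[of \<beta> 0 0] by simp

lemma p_minus: "p \<beta> (- x) = p \<beta> x"
  using p_emb_mult[of \<beta> "- 1" x] by (simp add: emb_minus)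

lemma p_minus_commute: "p \<beta> (x - y) = p \<beta> (y - x)"
  using p_minus[of \<beta> "x - y"] by simp

lemma p_diff: "p \<beta> (x - y) \<le> p \<beta> x + p \<beta> y"
  using p_add[of \<beta> x "- y"] by (simp add: p_minus)

lemma p_nonneg: "0 \<le> p \<beta> x"
  using p_add[of \<beta> x "- x"] by (simp add: p_minus p_zero)

lemma p_power: "p \<beta> (x ^ n) \<le> p \<beta> x ^ n"
proof (induction n)
  case (Suc n)
  have "p \<beta> (x ^ Suc n) \<le> p \<beta> x * p \<beta> (x ^ n)"
    by (simp add: p_mult)
  also have "\<dots> \<le> p \<beta> x * p \<beta> x ^ n"
    using Suc by (simp add: mult_left_mono p_nonneg)
  finally show ?case by simp
qed (simp add: p_one)

text \<open>Telescoping yields the exponent \<open>n - 1\<close> on \<open>B\<close>; since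
  \<open>1 \<le> B\<close>, the exponent \<open>n\<close> is a valid weakening that avoids natural
  subtraction.\<close>

lemma p_power_diff:
  assumes "p \<beta> x \<le> B" "p \<beta> y \<le> B" "1 \<le> B"
  shows "p \<beta> (x ^ n - y ^ n) \<le> real n * B ^ n * p \<beta> (x - y)"
proof (induction n)
  case (Suc n)
  have "x ^ Suc n - y ^ Suc n = x * (x ^ n - y ^ n) + y ^ n * (x - y)"
    by (simp add: algebra_simps)
  then have "p \<beta> (x ^ Suc n - y ^ Suc n) \<le> p \<beta> x * p \<beta> (x ^ n - y ^ n) + p \<beta> (y ^ n) * p \<beta> (x - y)"
    by (simp only:) (rule order_trans[OF p_add add_mono[OF p_mult p_mult]])
  also have "\<dots> \<le> B * (real n * B ^ n * p \<beta> (x - y)) + B ^ Suc n * p \<beta> (x - y)"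
  proof (intro add_mono mult_mono mult_right_mono)
    have "p \<beta> (y ^ n) \<le> B ^ n"
      using p_power[of \<beta> y n] power_mono[OF assms(2) p_nonneg, of n] by linarith
    also have "\<dots> \<le> B ^ Suc n"
      using assms(3) by (intro power_increasing) auto
    finally show "p \<beta> (y ^ n) \<le> B ^ Suc n" .
  qed (use assms Suc p_nonneg in auto)
  finally show ?case by (simp add: algebra_simps)
qed (simp add: p_zero)

section \<open>Limits in the uniformity of the seminorms\<close>

lemma eventually_uniformity_p:
  assumes "0 < e"
  shows "\<forall>\<^sub>F (x, y) in uniformity. p \<beta> (x - y) < e"
proof -
  have "uniformity \<le> principal {(x, y). p \<beta> (x - y) < e}"
    unfolding uniformity_seminorms using assms by (intro INF_lower2[of \<beta>] INF_lower2[of e]) auto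
  then show ?thesis
    by (auto simp: le_principal case_prod_unfold)
qed

text \<open>The increments are summable for every seminorm, so the image filter is Cauchy for the
  uniformity, and completeness supplies one limit for all indices at once. The factor 2 is the sum
  of the geometric series.\<close>

lemma sequence_converges:
  assumes s: "\<And>\<beta> n. p \<beta> (s (Suc n) - s n) \<le> C \<beta> / 2 ^ n"
  obtains L where "\<And>\<beta> n. p \<beta> (L - s n) \<le> 2 * C \<beta> / 2 ^ n"
proof -
  have C: "0 \<le> C \<beta>" for \<beta>
    using s[of \<beta> 0] p_nonneg[of \<beta> "s (Suc 0) - s 0"] by simp
  \<comment> \<open>The right-hand side is the exact finite geometric sum, which lets the induction
    close.\<close>
  have step: "p \<beta> (s (n + k) - s n) \<le> 2 * C \<beta> * (1 / 2 ^ n - 1 / 2 ^ (n + k))" for \<beta> n k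
  proof (induction k)
    case (Suc k)
    have "p \<beta> (s (n + Suc k) - s n) \<le> p \<beta> (s (Suc (n + k)) - s (n + k)) + p \<beta> (s (n + k) - s n)"
      using p_add[of \<beta> "s (Suc (n + k)) - s (n + k)" "s (n + k) - s n"] by simp
    also have "\<dots> \<le> C \<beta> / 2 ^ (n + k) + 2 * C \<beta> * (1 / 2 ^ n - 1 / 2 ^ (n + k))"
      using s Suc by (intro add_mono)
    finally show ?case by (simp add: field_simps)
  qed (simp add: p_zero)
  have tail: "p \<beta> (s m - s n) \<le> 2 * C \<beta> / 2 ^ n" if "n \<le> m" for \<beta> m n
  proof -
    have "2 * C \<beta> * (1 / 2 ^ n - 1 / 2 ^ m) \<le> 2 * C \<beta> * (1 / 2 ^ n)"
      using C by (intro mult_left_mono) auto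
    then show ?thesis
      using step[of \<beta> n "m - n"] that by simp
  qed
  have lim: "(\<lambda>n. 2 * C \<beta> / 2 ^ n) \<longlonglongrightarrow> 0" for \<beta>
    by (rule LIMSEQ_divide_realpow_zero) simp
  have "cauchy_filter (filtermap s sequentially)"
    unfolding cauchy_filter_def uniformity_seminorms
  proof (intro INF_greatest)
    fix \<beta> e assume "e \<in> {0::real<..}"
    then have "\<forall>\<^sub>F n in sequentially. 2 * C \<beta> / 2 ^ n < e"
      using order_tendstoD(2)[OF lim] by auto
    then obtain N where N: "2 * C \<beta> / 2 ^ n < e" if "n \<ge> N" for n
      by (auto simp: eventually_sequentially)
    have close: "p \<beta> (s m - s n) < e" if "m \<ge> N" "n \<ge> N" for m n
      using tail[of n m \<beta>] tail[of m n \<beta>] N[OF that(1)] N[OF that(2)] p_minus_commute[of \<beta> "s m" "s n"]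
      by (cases "n \<le> m") auto
    have "\<forall>\<^sub>F (x, y) in filtermap s sequentially \<times>\<^sub>F filtermap s sequentially. p \<beta> (x - y) < e"
      unfolding eventually_prod_filter eventually_filtermap
      by (rule exI[of _ "\<lambda>x. x \<in> s ` {N..}"], rule exI[of _ "\<lambda>x. x \<in> s ` {N..}"])
        (auto simp: close eventually_sequentially intro!: exI[of _ N])
    then show "filtermap s sequentially \<times>\<^sub>F filtermap s sequentially
        \<le> principal {(x, y). p \<beta> (x - y) < e}"
      by (auto simp: le_principal case_prod_unfold)
  qed
  then obtain L where L: "filtermap s sequentially \<le> nhds L"
    using cauchy_filter_complete_converges[OF _ complete, of "filtermap s sequentially"] by (auto simp: filtermap_bot_iff)
  have "p \<beta> (L - s n) \<le> 2 * C \<beta> / 2 ^ n" for \<beta> n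
  proof (rule field_le_epsilon)
    fix e :: real assume "0 < e"
    have "\<forall>\<^sub>F x in nhds L. p \<beta> (L - x) < e"
      using eventually_uniformity_p[OF \<open>0 < e\<close>, of \<beta>]
      unfolding eventually_nhds_uniformity by (auto elim: eventually_mono)
    then have "\<forall>\<^sub>F m in sequentially. p \<beta> (L - s m) < e"
      using L unfolding le_filter_def eventually_filtermap by blast
    then obtain N where "p \<beta> (L - s m) < e" if "N \<le> m" for m
      by (auto simp: eventually_sequentially)
    then obtain m where m: "n \<le> m" "p \<beta> (L - s m) < e"
      by (meson max.cobounded1 max.cobounded2)
    show "p \<beta> (L - s n) \<le> 2 * C \<beta> / 2 ^ n + e"
      using p_add[of \<beta> "L - s m" "s m - s n"] tail[OF m(1), of \<beta>] m(2) by simp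
  qed
  then show thesis using that by blast
qed

text \<open>
  The element \<open>u\<close> is \<open>exp (\<i> h)\<close>, obtained as the limit of the powers \<open>(1 + \<i> h / 2 ^ k) ^ (2 ^ k)\<close>,
  whose seminorms the \<open>C\<^sup>*\<close>-identity controls without an exponential law.
\<close>

lemma unitary_near:
  assumes h: "star h = h"
  obtains u where "\<And>\<beta>. p \<beta> u \<le> 1"
    and "\<And>\<beta>. p \<beta> (u - (1 + emb \<i> * h)) \<le> exp ((p \<beta> h)\<^sup>2 / 2) * (p \<beta> h)\<^sup>2 / 2"
proof -
  define w where "w k = 1 + emb (\<i> / 2 ^ k) * h" for k :: nat
  define v where "v k = w k ^ (2 ^ k)" for k
  have p_hh: "p \<beta> (emb (1 / 4 ^ k) * h\<^sup>2) \<le> (p \<beta> h)\<^sup>2 / 4 ^ k" for \<beta> k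
    using p_power[of \<beta> h 2] by (simp add: p_emb_mult norm_divide norm_power divide_right_mono)
  \<comment> \<open>As \<open>h\<close> is self-adjoint, the linear terms of
    \<open>star (w k) * w k\<close> cancel. So \<open>p \<beta> (w k)\<close> exceeds
    \<open>1\<close> by at most a quantity of order \<open>1 / 4 ^ k\<close>, and its
    \<open>2 ^ k\<close>-th power stays bounded.\<close>
  have w_bound: "p \<beta> (w k) \<le> exp ((p \<beta> h)\<^sup>2 / (2 * 4 ^ k))" for \<beta> k
  proof -
    have ii: "emb (\<i> / 2 ^ k) * emb (\<i> / 2 ^ k) = - emb (1 / 4 ^ k)"
      by (simp add: emb_mult[symmetric] emb_minus[symmetric] power_mult_distrib[symmetric])
    have "star (w k) * w k = 1 - (emb (\<i> / 2 ^ k) * emb (\<i> / 2 ^ k)) * h\<^sup>2"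
      by (simp add: w_def star_add star_one star_mult star_emb h emb_minus algebra_simps power2_eq_square)
    then have "star (w k) * w k = 1 + emb (1 / 4 ^ k) * h\<^sup>2"
      unfolding ii by simp
    then have "(p \<beta> (w k))\<^sup>2 \<le> 1 + (p \<beta> h)\<^sup>2 / 4 ^ k"
      using p_add[of \<beta> 1 "emb (1 / 4 ^ k) * h\<^sup>2"] p_hh[of \<beta> k] by (simp add: p_cstar[symmetric] p_one)
    also have "\<dots> \<le> exp ((p \<beta> h)\<^sup>2 / 4 ^ k)"
      by (rule exp_ge_add_one_self)
    also have "\<dots> = (exp ((p \<beta> h)\<^sup>2 / (2 * 4 ^ k)))\<^sup>2"
      by (simp add: exp_double[symmetric])
    finally show ?thesis
      by (rule power2_le_imp_le) simp
  qed
  have pow: "exp ((p \<beta> h)\<^sup>2 / (2 * 4 ^ k)) ^ (2 ^ k) = exp ((p \<beta> h)\<^sup>2 / (2 * 2 ^ k))" for \<beta> k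
  proof -
    have "(4::real) ^ k = 2 ^ k * 2 ^ k" by (simp add: power_mult_distrib[symmetric])
    then show ?thesis by (simp add: exp_of_nat_mult[symmetric])
  qed
  have v_bound: "p \<beta> (v k) \<le> exp ((p \<beta> h)\<^sup>2 / (2 * 2 ^ k))" for \<beta> k
    using p_power[of \<beta> "w k" "2 ^ k"] power_mono[OF w_bound[of \<beta> k] p_nonneg, of "2 ^ k"]
    unfolding v_def pow by linarith
  \<comment> \<open>\<open>v (Suc k)\<close> is the \<open>2 ^ k\<close>-th power of
    \<open>(w (Suc k))\<^sup>2\<close>, which differs from \<open>w k\<close> by a term of order
    \<open>1 / 4 ^ k\<close>. The power costs a factor \<open>2 ^ k\<close>, and
    \<open>1 / 2 ^ k\<close> remains.\<close>
  have v_step: "p \<beta> (v (Suc k) - v k) \<le> exp ((p \<beta> h)\<^sup>2 / 2) * (p \<beta> h)\<^sup>2 / 4 / 2 ^ k" for \<beta> k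
  proof -
    define B where "B = exp ((p \<beta> h)\<^sup>2 / (2 * 4 ^ k))"
    have e1: "emb (\<i> / 2 ^ Suc k) + emb (\<i> / 2 ^ Suc k) = emb (\<i> / 2 ^ k)"
      by (simp add: emb_add[symmetric])
    have e2: "emb (\<i> / 2 ^ Suc k) * emb (\<i> / 2 ^ Suc k) = - emb (1 / 4 ^ Suc k)"
      by (simp add: emb_mult[symmetric] emb_minus[symmetric] power_mult_distrib[symmetric])
    have "(w (Suc k))\<^sup>2 = 1 + (emb (\<i> / 2 ^ Suc k) + emb (\<i> / 2 ^ Suc k)) * h
        + (emb (\<i> / 2 ^ Suc k) * emb (\<i> / 2 ^ Suc k)) * h\<^sup>2"
      unfolding w_def by (simp only: power2_eq_square) (simp only: algebra_simps mult_1_right mult_1_left)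
    then have "(w (Suc k))\<^sup>2 - w k = - (emb (1 / 4 ^ Suc k) * h\<^sup>2)"
      unfolding e1 e2 w_def by simp
    then have d: "p \<beta> ((w (Suc k))\<^sup>2 - w k) \<le> (p \<beta> h)\<^sup>2 / 4 ^ Suc k"
      using p_hh[of \<beta> "Suc k"] by (simp only: p_minus)
    have "p \<beta> ((w (Suc k))\<^sup>2) \<le> (exp ((p \<beta> h)\<^sup>2 / (2 * 4 ^ Suc k)))\<^sup>2"
      using p_power[of \<beta> "w (Suc k)" 2] power_mono[OF w_bound[of \<beta> "Suc k"] p_nonneg, of 2] by linarith
    also have "\<dots> = exp ((p \<beta> h)\<^sup>2 / (4 * 4 ^ k))"
      by (simp add: exp_double[symmetric])
    also have "\<dots> \<le> B"
      unfolding B_def by (simp add: frac_le)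
    finally have "p \<beta> (((w (Suc k))\<^sup>2) ^ (2 ^ k) - w k ^ (2 ^ k))
        \<le> real (2 ^ k) * B ^ (2 ^ k) * p \<beta> ((w (Suc k))\<^sup>2 - w k)"
      using w_bound[of \<beta> k] by (intro p_power_diff) (auto simp: B_def)
    also have "\<dots> \<le> real (2 ^ k) * exp ((p \<beta> h)\<^sup>2 / 2) * ((p \<beta> h)\<^sup>2 / 4 ^ Suc k)"
    proof (intro mult_mono)
      have "(p \<beta> h)\<^sup>2 / (2 * 2 ^ k) \<le> (p \<beta> h)\<^sup>2 / 2"
        by (intro frac_le) auto
      then show "B ^ (2 ^ k) \<le> exp ((p \<beta> h)\<^sup>2 / 2)"
        unfolding B_def pow by simp
    qed (use d p_nonneg in \<open>auto simp: B_def\<close>)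
    also have "\<dots> = exp ((p \<beta> h)\<^sup>2 / 2) * (p \<beta> h)\<^sup>2 / 4 / 2 ^ k"
      using power_mult_distrib[of 2 "2::real" k] by (simp add: field_simps)
    finally show ?thesis
      by (simp add: v_def power_mult[symmetric])
  qed
  obtain u where u: "\<And>\<beta> n. p \<beta> (u - v n) \<le> 2 * (exp ((p \<beta> h)\<^sup>2 / 2) * (p \<beta> h)\<^sup>2 / 4) / 2 ^ n"
    using sequence_converges[of v "\<lambda>\<beta>. exp ((p \<beta> h)\<^sup>2 / 2) * (p \<beta> h)\<^sup>2 / 4"] v_step by blast
  show thesis
  proof
    fix \<beta>
    define c where "c = 2 * (exp ((p \<beta> h)\<^sup>2 / 2) * (p \<beta> h)\<^sup>2 / 4)"
    \<comment> \<open>The bounds for \<open>v n\<close> tend to \<open>1\<close>, so the limit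
      satisfies the sharp bound although the \<open>v n\<close> need not.\<close>
    have "(\<lambda>n. c / 2 ^ n + exp ((p \<beta> h)\<^sup>2 / 2 / 2 ^ n)) \<longlonglongrightarrow> 0 + exp 0"
      by (intro tendsto_add tendsto_exp LIMSEQ_divide_realpow_zero) auto
    moreover have "p \<beta> u \<le> c / 2 ^ n + exp ((p \<beta> h)\<^sup>2 / 2 / 2 ^ n)" for n
      using p_add[of \<beta> "u - v n" "v n"] u[of \<beta> n] v_bound[of \<beta> n]
      by (simp add: c_def)
    ultimately have "p \<beta> u \<le> 0 + exp 0"
      using LIMSEQ_le_const by blast
    then show "p \<beta> u \<le> 1"
      by simp
    \<comment> \<open>This is the distance of the limit from the initial term, because
      \<open>v 0 = 1 + emb \<i> * h\<close>.\<close>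
    show "p \<beta> (u - (1 + emb \<i> * h)) \<le> exp ((p \<beta> h)\<^sup>2 / 2) * (p \<beta> h)\<^sup>2 / 2"
      using u[of \<beta> 0] by (simp add: v_def w_def mult.commute)
  qed
qed

text \<open>The approximant is \<open>R sin (h / R)\<close> with \<open>R = 4 p \<alpha> h\<close>.\<close>

lemma bounded_approximation:
  assumes h: "star h = h"
  obtains y where "star y = y" and "\<And>\<beta>. p \<beta> y \<le> 4 * p \<alpha> h" and "p \<alpha> (h - y) \<le> p \<alpha> h / 2"
proof (cases "p \<alpha> h = 0")
  case True
  then show thesis using that[of 0] by (simp add: star_zero p_zero)
next
  case False
  \<comment> \<open>The factor 4 gives \<open>p \<alpha> k = 1 / 4\<close>, for which the remainder
    \<open>exp (1 / 32) / 32\<close> is below \<open>1 / 8\<close>.\<close>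
  define R where "R = 4 * p \<alpha> h"
  have R: "0 < R" using False p_nonneg[of \<alpha> h] by (simp add: R_def)
  define k where "k = emb (of_real (1 / R)) * h"
  have k: "star k = k" by (simp add: k_def star_mult star_emb h mult.commute)
  have pk: "p \<alpha> k = 1 / 4" using R False by (simp add: k_def p_emb_mult norm_divide R_def)
  obtain u where u: "\<And>\<beta>. p \<beta> u \<le> 1"
    "\<And>\<beta>. p \<beta> (u - (1 + emb \<i> * k)) \<le> exp ((p \<beta> k)\<^sup>2 / 2) * (p \<beta> k)\<^sup>2 / 2"
    using unitary_near[OF k] by blast
  have "exp (1 / 32 :: real) \<le> exp 1" by simp
  also have "\<dots> \<le> 3" by (rule exp_le)
  finally have "exp (1 / 32 :: real) \<le> 3" .
  then have near: "p \<alpha> (u - (1 + emb \<i> * k)) \<le> 1 / 8"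
    using u(2)[of \<alpha>] by (simp add: pk power2_eq_square)
  \<comment> \<open>With \<open>u\<close> in the role of \<open>exp (\<i> k)\<close>, this is
    \<open>R\<close> times \<open>(u - star u) / (2 \<i>)\<close>, the sine of
    \<open>k\<close>.\<close>
  define y where "y = emb (of_real R * (- \<i> / 2)) * (u - star u)"
  show thesis
  proof
    show "star y = y"
      by (simp add: y_def star_mult star_emb star_diff star_star emb_minus algebra_simps)
    show "p \<beta> y \<le> 4 * p \<alpha> h" for \<beta>
    proof -
      have "p \<beta> (u - star u) \<le> 2" using p_diff[of \<beta> u "star u"] u(1)[of \<beta>] by (simp add: p_star)
      then show ?thesis
        using R mult_left_mono[of "p \<beta> (u - star u)" 2 R] by (simp add: y_def p_emb_mult norm_mult R_def)
    qed
    \<comment> \<open>\<open>d\<close> is the remainder after the linear term. In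
      \<open>u - star u\<close> the ones cancel and the linear terms add up to
      \<open>2 \<i> k\<close>, which the factor in \<open>y\<close> turns back into
      \<open>h\<close>.\<close>
    define d where "d = u - (1 + emb \<i> * k)"
    have sd: "star d = star u - (1 - emb \<i> * k)"
      by (simp add: d_def star_diff star_add star_one star_mult star_emb k emb_minus mult.commute)
    have "emb (of_real R * (- \<i> / 2)) * (emb 2 * emb \<i> * emb (of_real (1 / R))) = 1"
      using R by (simp add: emb_mult[symmetric])
    then have "h = emb (of_real R * (- \<i> / 2)) * (emb 2 * emb \<i> * emb (of_real (1 / R))) * h"
      by simp
    also have "\<dots> = emb (of_real R * (- \<i> / 2)) * (emb 2 * (emb \<i> * k))"
      by (simp only: k_def mult.assoc)
    also have "emb 2 * (emb \<i> * k) = emb \<i> * k + emb \<i> * k"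
      using emb_add[of 1 1] by (simp add: distrib_right)
    finally have "h = emb (of_real R * (- \<i> / 2)) * (emb \<i> * k + emb \<i> * k)" .
    moreover have "d - star d = (u - star u) - (emb \<i> * k + emb \<i> * k)"
      unfolding sd by (simp add: d_def)
    ultimately have "h - y = - (emb (of_real R * (- \<i> / 2)) * (d - star d))"
      unfolding y_def by (simp only: right_diff_distrib) simp
    then have "p \<alpha> (h - y) = R / 2 * p \<alpha> (d - star d)"
      using R by (simp only: p_minus p_emb_mult norm_mult) simp
    also have "\<dots> \<le> R / 2 * (1 / 4)"
      using p_diff[of \<alpha> d "star d"] near R by (intro mult_left_mono) (auto simp: p_star d_def)
    finally show "p \<alpha> (h - y) \<le> p \<alpha> h / 2" by (simp add: R_def)
  qed
qed

text \<open>The error of \<open>bounded_approximation\<close> is again self-adjoint with at most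
  half the \<open>p \<alpha>\<close>-seminorm. Iterating, the approximants form a series dominated
  by \<open>4 * p \<alpha> h / 2 ^ n\<close> in every seminorm, whence the factor 8, while the
  errors tend to zero for \<open>p \<alpha>\<close>.\<close>

lemma bounded_representative:
  assumes h: "star h = h"
  obtains g where "p \<alpha> (g - h) = 0" and "\<And>\<beta>. p \<beta> g \<le> 8 * p \<alpha> h"
proof -
  \<comment> \<open>The implication inside the existential lets choice produce a total
    \<open>Y\<close>, used only at self-adjoint arguments.\<close>
  have "\<exists>y. star x = x \<longrightarrow> star y = y \<and> (\<forall>\<beta>. p \<beta> y \<le> 4 * p \<alpha> x) \<and> p \<alpha> (x - y) \<le> p \<alpha> x / 2" for x
    using bounded_approximation[of x \<alpha>] by metis
  then obtain Y where Y: "star (Y x) = Y x" "p \<beta> (Y x) \<le> 4 * p \<alpha> x" "p \<alpha> (x - Y x) \<le> p \<alpha> x / 2"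
    if "star x = x" for x \<beta>
    by metis
  define r where "r n = ((\<lambda>x. x - Y x) ^^ n) h" for n
  have r0: "r 0 = h" and rS: "r (Suc n) = r n - Y (r n)" for n by (simp_all add: r_def)
  have r: "star (r n) = r n \<and> p \<alpha> (r n) \<le> p \<alpha> h / 2 ^ n" for n
  proof (induction n)
    case (Suc n)
    then have "star (r (Suc n)) = r (Suc n)" by (simp add: rS star_diff Y)
    moreover have "p \<alpha> (r (Suc n)) \<le> p \<alpha> (r n) / 2" using Suc Y(3) by (simp add: rS)
    moreover have "p \<alpha> (r n) / 2 \<le> p \<alpha> h / 2 ^ Suc n" using Suc by simp
    ultimately show ?case by (meson order_trans)
  qed (simp add: r0 h)
  \<comment> \<open>\<open>h - r n\<close> is the sum of the first \<open>n\<close>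
    approximants.\<close>
  have "p \<beta> ((h - r (Suc n)) - (h - r n)) \<le> 4 * p \<alpha> h / 2 ^ n" for \<beta> n
  proof -
    have "p \<beta> (Y (r n)) \<le> 4 * p \<alpha> (r n)" using r Y(2) by blast
    also have "\<dots> \<le> 4 * (p \<alpha> h / 2 ^ n)" using r[of n] by simp
    finally show ?thesis by (simp add: rS)
  qed
  then obtain g where g: "\<And>\<beta> n. p \<beta> (g - (h - r n)) \<le> 2 * (4 * p \<alpha> h) / 2 ^ n"
    using sequence_converges[of "\<lambda>n. h - r n" "\<lambda>_. 4 * p \<alpha> h"] by blast
  have "p \<alpha> (g - h) \<le> 9 * p \<alpha> h / 2 ^ n" for n
    using p_diff[of \<alpha> "g - (h - r n)" "r n"] g[of \<alpha> n] r[of n] by simp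
  moreover have "(\<lambda>n. 9 * p \<alpha> h / 2 ^ n) \<longlonglongrightarrow> 0"
    by (rule LIMSEQ_divide_realpow_zero) simp
  ultimately have "p \<alpha> (g - h) \<le> 0"
    using LIMSEQ_le_const by blast
  then show thesis
    using that[of g] g[of _ 0] p_nonneg[of \<alpha> "g - h"] by (simp add: r0)
qed

text \<open>The Neumann series of \<open>g\<close> converges because one bound below
  \<open>1\<close> holds for all seminorms simultaneously.\<close>

lemma one_minus_invertible:
  assumes g: "\<And>\<beta>. p \<beta> g \<le> 1 / 2"
  obtains z where "\<And>\<beta>. p \<beta> ((1 - g) * z - 1) = 0"
proof -
  have pow: "p \<beta> (g ^ n) \<le> 1 / 2 ^ n" for \<beta> n
    using p_power[of \<beta> g n] power_mono[OF g p_nonneg, of \<beta> n] by (simp add: power_one_over)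
  have "p \<beta> ((\<Sum>i<Suc n. g ^ i) - (\<Sum>i<n. g ^ i)) \<le> 1 / 2 ^ n" for \<beta> n
    using pow by simp
  then obtain z where z: "\<And>\<beta> n. p \<beta> (z - (\<Sum>i<n. g ^ i)) \<le> 2 * 1 / 2 ^ n"
    using sequence_converges[of "\<lambda>n. \<Sum>i<n. g ^ i" "\<lambda>_. 1"] by blast
  have "p \<beta> ((1 - g) * z - 1) = 0" for \<beta>
  proof -
    have "p \<beta> ((1 - g) * z - 1) \<le> 5 / 2 ^ n" for n
    proof -
      \<comment> \<open>The partial sums telescope. With \<open>p \<beta> (1 - g) \<le> 2\<close>
        the two errors add up to \<open>5 / 2 ^ n\<close>.\<close>
      have "(1 - g) * z - 1 = (1 - g) * (z - (\<Sum>i<n. g ^ i)) - g ^ n"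
        using power_diff_1_eq[of g n] by (simp add: algebra_simps)
      then have "p \<beta> ((1 - g) * z - 1) \<le> p \<beta> (1 - g) * p \<beta> (z - (\<Sum>i<n. g ^ i)) + p \<beta> (g ^ n)"
        by (metis add_right_mono order_trans p_diff p_mult)
      also have "\<dots> \<le> 2 * (2 * 1 / 2 ^ n) + 1 / 2 ^ n"
        using z pow p_diff[of \<beta> 1 g] g[of \<beta>]
        by (intro add_mono mult_mono) (auto simp: p_one p_nonneg)
      finally show ?thesis by simp
    qed
    moreover have "(\<lambda>n. 5 / 2 ^ n :: real) \<longlonglongrightarrow> 0"
      by (rule LIMSEQ_divide_realpow_zero) simp
    ultimately have "p \<beta> ((1 - g) * z - 1) \<le> 0"
      using LIMSEQ_le_const by blast
    then show ?thesis using p_nonneg by (simp add: order_antisym)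
  qed
  then show thesis using that by blast
qed

end

section \<open>Characters and maximal ideals\<close>

lemma ideal_ring_of_type_algebra_iff:
  fixes J :: "'a::comm_ring_1 set"
  shows "ideal J ring_of_type_algebra \<longleftrightarrow>
    0 \<in> J \<and> (\<forall>x\<in>J. \<forall>y\<in>J. x + y \<in> J) \<and> (\<forall>r. \<forall>x\<in>J. r * x \<in> J)" (is "_ \<longleftrightarrow> ?R")
proof
  assume "ideal J (ring_of_type_algebra :: 'a ring)"
  then interpret ideal J "ring_of_type_algebra :: 'a ring" .
  show ?R
    using additive_subgroup.zero_closed[OF is_additive_subgroup]
      additive_subgroup.a_closed[OF is_additive_subgroup] I_l_closed
    by (simp add: ring_of_type_algebra_def)
next
  assume R: ?R
  show "ideal J (ring_of_type_algebra :: 'a ring)"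
  proof (rule idealI)
    show "ring (ring_of_type_algebra :: 'a ring)"
      by (rule ring_from_type_algebra)
    have minus: "- x \<in> J" if "x \<in> J" for x
      using R that by (metis mult_minus1)
    have inv: "inv\<^bsub>add_monoid ring_of_type_algebra\<^esub> x = - x" for x :: 'a
      unfolding m_inv_def
      by (rule the_equality) (auto simp: ring_of_type_algebra_def eq_neg_iff_add_eq_0)
    show "subgroup J (add_monoid (ring_of_type_algebra :: 'a ring))"
    proof (rule subgroup.intro)
      show "inv\<^bsub>add_monoid ring_of_type_algebra\<^esub> x \<in> J" if "x \<in> J" for x
        unfolding inv using that by (rule minus)
    qed (use R in \<open>auto simp: ring_of_type_algebra_def\<close>)
    have "x * r \<in> J" if "x \<in> J" for x r
      using R that by (simp add: mult.commute[of x r])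
    then show "x \<otimes>\<^bsub>ring_of_type_algebra\<^esub> r \<in> J" if "x \<in> J" for x r
      using that by (simp add: ring_of_type_algebra_def)
  qed (use R in \<open>auto simp: ring_of_type_algebra_def\<close>)
qed

text \<open>The ideal generated by \<open>J\<close> and \<open>x\<close> is strictly larger than
  \<open>J\<close>, hence contains \<open>1\<close>.\<close>

lemma maximalideal_inverse:
  fixes J :: "'a::comm_ring_1 set"
  assumes J: "maximalideal J ring_of_type_algebra" and x: "x \<notin> J"
  shows "\<exists>y. x * y - 1 \<in> J"
proof -
  interpret maximalideal J "ring_of_type_algebra :: 'a ring" by (rule J)
  have J': "0 \<in> J" "\<And>x y. x \<in> J \<Longrightarrow> y \<in> J \<Longrightarrow> x + y \<in> J" "\<And>r x. x \<in> J \<Longrightarrow> r * x \<in> J"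
    using is_ideal by (auto simp: ideal_ring_of_type_algebra_iff)
  define K where "K = {j + x * y | j y. j \<in> J}"
  have JK: "J \<subseteq> K"
  proof
    fix j assume "j \<in> J"
    then show "j \<in> K" unfolding K_def by (intro CollectI exI[of _ j] exI[of _ 0]) simp
  qed
  have "ideal K ring_of_type_algebra"
    unfolding ideal_ring_of_type_algebra_iff
  proof (intro conjI ballI allI)
    show "0 \<in> K" using J'(1) JK by blast
  next
    fix u v assume "u \<in> K" "v \<in> K"
    then obtain j y k z where "u = j + x * y" "v = k + x * z" "j \<in> J" "k \<in> J"
      unfolding K_def by blast
    then show "u + v \<in> K"
      unfolding K_def by (intro CollectI exI[of _ "j + k"] exI[of _ "y + z"])
        (simp add: J' algebra_simps)
  next
    fix r u assume "u \<in> K"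
    then obtain j y where "u = j + x * y" "j \<in> J"
      unfolding K_def by blast
    then show "r * u \<in> K"
      unfolding K_def by (intro CollectI exI[of _ "r * j"] exI[of _ "r * y"])
        (simp add: J' distrib_left mult.left_commute)
  qed
  then have "K = J \<or> K = UNIV"
    using I_maximal[of K] JK by (simp add: ring_of_type_algebra_def)
  moreover have "x \<in> K"
    unfolding K_def by (intro CollectI exI[of _ 0] exI[of _ 1]) (simp add: J')
  ultimately have "1 \<in> K" using x by blast
  then obtain j y where jy: "1 = j + x * y" "j \<in> J"
    unfolding K_def by blast
  then have "x * y - 1 = - 1 * j" by (simp add: algebra_simps)
  then show ?thesis using J'(3)[OF jy(2)] by metis
qed

lemma maximalideal_one_notin:
  fixes J :: "'a::comm_ring_1 set"
  assumes "maximalideal J ring_of_type_algebra"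
  shows "1 \<notin> J"
proof
  assume one: "1 \<in> J"
  interpret maximalideal J "ring_of_type_algebra :: 'a ring" by (rule assms)
  have "x * 1 \<in> J" for x
    using is_ideal one unfolding ideal_ring_of_type_algebra_iff by blast
  then show False
    using I_notcarr by (auto simp: ring_of_type_algebra_def)
qed

section \<open>Cosets and the quotient ring\<close>

context
  fixes I :: "'a::comm_ring_1 set"
  assumes I: "ideal I ring_of_type_algebra"
begin

lemma quotient_proj_eq_iff: "quotient_proj I a = quotient_proj I b \<longleftrightarrow> a - b \<in> I"
proof -
  have I': "0 \<in> I" "\<And>x y. x \<in> I \<Longrightarrow> y \<in> I \<Longrightarrow> x + y \<in> I" "\<And>r x. x \<in> I \<Longrightarrow> r * x \<in> I"
    using I by (auto simp: ideal_ring_of_type_algebra_iff)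
  have mem: "x \<in> quotient_proj I c \<longleftrightarrow> x - c \<in> I" for x c
    by (auto simp: quotient_proj_def a_r_coset_def' ring_of_type_algebra_def)
      (metis diff_add_cancel)
  show ?thesis
  proof
    assume "quotient_proj I a = quotient_proj I b"
    then show "a - b \<in> I" using mem[of a a] mem[of a b] I'(1) by simp
  next
    assume ab: "a - b \<in> I"
    have "x - a \<in> I \<longleftrightarrow> x - b \<in> I" for x
      using I'(2)[OF _ ab, of "x - a"] I'(2)[OF _ I'(3)[OF ab, of "- 1"], of "x - b"] by auto
    then show "quotient_proj I a = quotient_proj I b" using mem by blast
  qed
qed

lemma carrier_Quot: "carrier (ring_of_type_algebra Quot I) = range (quotient_proj I)"
  by (auto simp: FactRing_def A_RCOSETS_def' quotient_proj_def ring_of_type_algebra_def)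

lemma quotient_proj_add:
  "quotient_proj I a \<oplus>\<^bsub>ring_of_type_algebra Quot I\<^esub> quotient_proj I b = quotient_proj I (a + b)"
proof -
  interpret ideal I "ring_of_type_algebra :: 'a ring" by (rule I)
  show ?thesis
    using a_rcos_sum[of a b] by (simp add: FactRing_def quotient_proj_def ring_of_type_algebra_def)
qed

lemma quotient_proj_mult:
  "quotient_proj I a \<otimes>\<^bsub>ring_of_type_algebra Quot I\<^esub> quotient_proj I b = quotient_proj I (a * b)"
proof -
  interpret ideal I "ring_of_type_algebra :: 'a ring" by (rule I)
  show ?thesis
    using rcoset_mult_add[of a b] by (simp add: FactRing_def quotient_proj_def ring_of_type_algebra_def)
qed

lemma mem_quotient_proj_self: "a \<in> quotient_proj I a"
proof -
  have "0 \<in> I" using I by (simp add: ideal_ring_of_type_algebra_iff)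
  then show ?thesis
    by (force simp: quotient_proj_def a_r_coset_def' ring_of_type_algebra_def)
qed

lemma mem_quotient_proj: "x \<in> quotient_proj I a \<Longrightarrow> x - a \<in> I"
  by (auto simp: quotient_proj_def a_r_coset_def' ring_of_type_algebra_def)

end

section \<open>Characters of the quotients, pulled back to the algebra\<close>

definition character_mod ::
    "(complex \<Rightarrow> 'a::ring_1 \<Rightarrow> 'a) \<Rightarrow> 'a set \<Rightarrow> ('a \<Rightarrow> complex) \<Rightarrow> bool" where
  "character_mod scaleC I \<chi> \<longleftrightarrow>
     (\<forall>a\<in>I. \<chi> a = 0) \<and> (\<forall>a b. \<chi> (a + b) = \<chi> a + \<chi> b) \<and>
     (\<forall>c a. \<chi> (scaleC c a) = c * \<chi> a) \<and>
     (\<forall>a b. \<chi> (a * b) = \<chi> a * \<chi> b) \<and> (\<exists>a. \<chi> a \<noteq> 0)"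

context comm_locally_cstar_algebra
begin

lemma p_null_mult: "p \<alpha> x = 0 \<Longrightarrow> p \<alpha> (y * x) = 0"
  using p_mult[of \<alpha> y x] p_nonneg[of \<alpha> "y * x"] by simp

lemma p_null_add: "p \<alpha> x = 0 \<Longrightarrow> p \<alpha> y = 0 \<Longrightarrow> p \<alpha> (x + y) = 0"
  using p_add[of \<alpha> x y] p_nonneg[of \<alpha> "x + y"] by simp

lemma ideal_null_ideal: "ideal (null_ideal (p \<alpha>)) ring_of_type_algebra"
  by (auto simp: ideal_ring_of_type_algebra_iff null_ideal_def p_zero p_null_add p_null_mult)

text \<open>All cosets in the union coincide, because the null ideal is closed under scalars, and
  the union is not empty.\<close>

lemma quotient_scale_proj:
  "quotient_scale scaleC (null_ideal (p \<alpha>)) c (quotient_proj (null_ideal (p \<alpha>)) a) =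
     quotient_proj (null_ideal (p \<alpha>)) (scaleC c a)"
proof -
  let ?I = "null_ideal (p \<alpha>)"
  have "quotient_proj ?I (scaleC c x) = quotient_proj ?I (scaleC c a)"
    if "x \<in> quotient_proj ?I a" for x
  proof -
    have "scaleC c x - scaleC c a = emb c * (x - a)"
      by (simp add: scale_emb right_diff_distrib)
    then have "scaleC c x - scaleC c a \<in> ?I"
      using mem_quotient_proj[OF ideal_null_ideal that] by (simp add: null_ideal_def p_null_mult)
    then show ?thesis
      by (simp only: quotient_proj_eq_iff[OF ideal_null_ideal])
  qed
  then show ?thesis
    using mem_quotient_proj_self[OF ideal_null_ideal[of \<alpha>], of a] unfolding quotient_scale_def by blast
qed

lemma character_mod_comp:
  assumes "\<phi> \<in> quotient_characters scaleC (null_ideal (p \<alpha>))"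
  shows "character_mod scaleC (null_ideal (p \<alpha>)) (\<phi> \<circ> quotient_proj (null_ideal (p \<alpha>)))"
proof -
  let ?\<pi> = "quotient_proj (null_ideal (p \<alpha>))"
  note I = ideal_null_ideal[of \<alpha>]
  have add: "\<phi> (?\<pi> (a + b)) = \<phi> (?\<pi> a) + \<phi> (?\<pi> b)"
    and scale: "\<phi> (?\<pi> (scaleC c a)) = c * \<phi> (?\<pi> a)"
    and mult: "\<phi> (?\<pi> (a * b)) = \<phi> (?\<pi> a) * \<phi> (?\<pi> b)" for a b c
    using assms
    by (simp_all add: quotient_characters_def Let_def carrier_Quot[OF I]
        quotient_proj_add[OF I, symmetric] quotient_proj_mult[OF I, symmetric]
        quotient_scale_proj[symmetric])
  have "\<exists>a. \<phi> (?\<pi> a) \<noteq> 0"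
    using assms by (auto simp: quotient_characters_def Let_def carrier_Quot[OF I])
  moreover have "\<phi> (?\<pi> a) = 0" if "a \<in> null_ideal (p \<alpha>)" for a
  proof -
    have "?\<pi> a = ?\<pi> 0" using that by (simp add: quotient_proj_eq_iff[OF I])
    then show ?thesis using add[of 0 0] by simp
  qed
  ultimately show ?thesis
    using add scale mult by (simp add: character_mod_def)
qed

lemma character_mod_factors:
  assumes \<chi>: "character_mod scaleC (null_ideal (p \<alpha>)) \<chi>"
  shows "\<exists>\<phi>\<in>quotient_characters scaleC (null_ideal (p \<alpha>)). \<chi> = \<phi> \<circ> quotient_proj (null_ideal (p \<alpha>))"
proof
  let ?\<pi> = "quotient_proj (null_ideal (p \<alpha>))"
  note I = ideal_null_ideal[of \<alpha>]
  \<comment> \<open>Any representative serves, as \<open>\<chi>\<close> is constant on cosets;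
    \<open>restrict\<close> supplies the value \<open>undefined\<close> that extensionality demands
    off the carrier.\<close>
  define \<phi> where "\<phi> = restrict (\<lambda>A. \<chi> (SOME a. ?\<pi> a = A)) (range ?\<pi>)"
  have \<phi>: "\<phi> (?\<pi> a) = \<chi> a" for a
  proof -
    define b where "b = (SOME b. ?\<pi> b = ?\<pi> a)"
    have "?\<pi> b = ?\<pi> a" unfolding b_def by (rule someI) (rule refl)
    then have "\<chi> (b - a) = 0"
      using \<chi> by (simp add: quotient_proj_eq_iff[OF I] character_mod_def)
    then have "\<chi> b = \<chi> a"
      using \<chi> by (metis add.left_neutral diff_add_cancel character_mod_def)
    then show ?thesis by (simp add: \<phi>_def b_def)
  qed
  show "\<chi> = \<phi> \<circ> ?\<pi>"
    by (simp add: fun_eq_iff \<phi>)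
  show "\<phi> \<in> quotient_characters scaleC (null_ideal (p \<alpha>))"
    using \<chi> unfolding character_mod_def quotient_characters_def Let_def carrier_Quot[OF I]
    by (auto simp: quotient_proj_add[OF I] quotient_proj_mult[OF I] quotient_scale_proj \<phi>)
      (simp add: \<phi>_def)
qed

text \<open>The pullbacks of quotient characters are exactly the functionals of
  \<open>character_mod\<close>, so cosets and extensionality disappear from here on.\<close>

lemma character_space_iff:
  "\<chi> \<in> character_space scaleC p \<longleftrightarrow> (\<exists>\<alpha>. character_mod scaleC (null_ideal (p \<alpha>)) \<chi>)"
  unfolding character_space_def using character_mod_comp character_mod_factors by blast

section \<open>The correspondence between characters and maximal ideals\<close>

lemma character_one:
  assumes "character_mod scaleC I \<chi>"
  shows "\<chi> 1 = 1"
proof -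
  obtain a where "\<chi> a \<noteq> 0" using assms by (auto simp: character_mod_def)
  moreover have "\<chi> a = \<chi> a * \<chi> 1" using assms by (metis mult.right_neutral character_mod_def)
  ultimately show ?thesis by simp
qed

lemma character_emb:
  assumes "character_mod scaleC I \<chi>"
  shows "\<chi> (emb c) = c"
  using assms character_one[OF assms] by (simp add: emb_def character_mod_def)

lemma character_diff:
  assumes "character_mod scaleC I \<chi>"
  shows "\<chi> (a - b) = \<chi> a - \<chi> b"
  using assms by (metis add_diff_cancel_right' diff_add_cancel character_mod_def)

text \<open>The kernel has codimension one: if \<open>\<chi> a \<noteq> 0\<close>, every
  \<open>z\<close> differs from a scalar multiple of \<open>a\<close> by an element of the
  kernel.\<close>

lemma maximalideal_kernel:
  assumes \<chi>: "character_mod scaleC I \<chi>"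
  shows "maximalideal {a. \<chi> a = 0} ring_of_type_algebra"
proof (rule maximalidealI)
  have \<chi>0: "\<chi> 0 = 0" using character_diff[OF \<chi>, of 0 0] by simp
  then show "ideal {a. \<chi> a = 0} ring_of_type_algebra"
    using \<chi> by (simp add: ideal_ring_of_type_algebra_iff character_mod_def)
  show "carrier ring_of_type_algebra \<noteq> {a. \<chi> a = 0}"
    using character_one[OF \<chi>] by (simp add: ring_of_type_algebra_def set_eq_iff) (metis zero_neq_one)
  fix K :: "'a set"
  assume K: "ideal K ring_of_type_algebra" "{a. \<chi> a = 0} \<subseteq> K"
  show "K = {a. \<chi> a = 0} \<or> K = carrier ring_of_type_algebra"
  proof (rule disjCI)
    assume "K \<noteq> carrier ring_of_type_algebra"
    then obtain z where z: "z \<notin> K" by (auto simp: ring_of_type_algebra_def)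
    have "\<chi> a = 0" if a: "a \<in> K" for a
    proof (rule ccontr)
      assume "\<chi> a \<noteq> 0"
      then have "\<chi> (z - emb (\<chi> z / \<chi> a) * a) = 0"
        using \<chi> by (simp add: character_diff[OF \<chi>] scale_emb[symmetric] character_mod_def)
      then have "z - emb (\<chi> z / \<chi> a) * a \<in> K" using K(2) by blast
      then have "z - emb (\<chi> z / \<chi> a) * a + emb (\<chi> z / \<chi> a) * a \<in> K"
        using K(1) a unfolding ideal_ring_of_type_algebra_iff by blast
      then show False using z by simp
    qed
    then show "K = {a. \<chi> a = 0}" using K(2) by blast
  qed
qed

text \<open>\<open>a - emb (\<chi> a)\<close> lies in the common kernel, and \<open>\<psi>\<close>
  takes the value \<open>c\<close> at \<open>emb c\<close>. The two characters may come from
  different indices.\<close>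

lemma inj_on_kernel: "inj_on (\<lambda>\<chi>. {a. \<chi> a = 0}) (character_space scaleC p)"
proof (rule inj_onI, rule ext)
  fix \<chi> \<psi> a
  assume "\<chi> \<in> character_space scaleC p" "\<psi> \<in> character_space scaleC p"
    and eq: "{a. \<chi> a = 0} = {a. \<psi> a = 0}"
  then obtain I I' where \<chi>: "character_mod scaleC I \<chi>" and \<psi>: "character_mod scaleC I' \<psi>"
    by (auto simp: character_space_iff)
  have "\<chi> (a - emb (\<chi> a)) = 0"
    by (simp add: character_diff[OF \<chi>] character_emb[OF \<chi>])
  then have "\<psi> (a - emb (\<chi> a)) = 0" using eq by blast
  then show "\<chi> a = \<psi> a"
    by (simp add: character_diff[OF \<psi>] character_emb[OF \<psi>])
qed

text \<open>An element of \<open>J\<close> too close to \<open>1\<close> yields a self-adjoint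
  \<open>h\<close> with \<open>1 - h\<close> in \<open>J\<close> and \<open>p \<alpha> h\<close>
  small. A uniformly small \<open>g\<close> congruent to \<open>h\<close> modulo the null ideal
  makes \<open>1 - g\<close> invertible modulo that ideal, which forces \<open>1\<close> into
  \<open>J\<close>.\<close>

lemma maximalideal_dist_one:
  assumes max: "maximalideal J ring_of_type_algebra" and null: "null_ideal (p \<alpha>) \<subseteq> J" and j: "j \<in> J"
  shows "1 / 64 \<le> p \<alpha> (1 - j)"
proof (rule ccontr)
  assume "\<not> 1 / 64 \<le> p \<alpha> (1 - j)"
  define x where "x = 1 - j"
  have x: "p \<alpha> x < 1 / 64" using \<open>\<not> 1 / 64 \<le> p \<alpha> (1 - j)\<close> by (simp add: x_def)
  have "ideal J ring_of_type_algebra"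
    using max by (rule maximalideal.axioms(1))
  then have J: "\<And>x y. x \<in> J \<Longrightarrow> y \<in> J \<Longrightarrow> x + y \<in> J" "\<And>r x. x \<in> J \<Longrightarrow> r * x \<in> J"
    by (auto simp: ideal_ring_of_type_algebra_iff)
  \<comment> \<open>\<open>h\<close> is chosen so that \<open>1 - h = star j * j\<close>. This
    belongs to \<open>J\<close> whether or not \<open>J\<close> is closed under
    \<open>star\<close>.\<close>
  define h where "h = x + star x - star x * x"
  have h: "star h = h"
    by (simp add: h_def star_add star_diff star_mult star_star add.commute)
  have "1 - h = star j * j"
    by (simp add: h_def x_def star_diff star_one algebra_simps)
  then have one_h: "1 - h \<in> J" using J(2)[OF j] by simp
  have "p \<alpha> h \<le> p \<alpha> (x + star x) + p \<alpha> (star x * x)"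
    unfolding h_def by (rule p_diff)
  also have "\<dots> \<le> p \<alpha> x + p \<alpha> x + p \<alpha> x * p \<alpha> x"
    using p_add[of \<alpha> x "star x"] by (simp add: p_star p_cstar power2_eq_square)
  also have "\<dots> \<le> 1 / 64 + 1 / 64 + 1 / 64 * 1"
    using x p_nonneg[of \<alpha> x] by (intro add_mono mult_mono) auto
  finally have ph: "p \<alpha> h \<le> 1 / 16" by simp
  obtain g where g: "p \<alpha> (g - h) = 0" "\<And>\<beta>. p \<beta> g \<le> 8 * p \<alpha> h"
    using bounded_representative[OF h] by blast
  \<comment> \<open>The threshold \<open>1 / 64\<close> is made for this: three such terms stay
    below \<open>1 / 16\<close>, and the factor 8 then gives \<open>1 / 2\<close>.\<close>
  have "p \<beta> g \<le> 1 / 2" for \<beta> using g(2)[of \<beta>] ph by simp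
  then obtain z where "p \<alpha> ((1 - g) * z - 1) = 0"
    using one_minus_invertible by blast
  then have "p \<alpha> (((1 - g) * z - 1) + z * (g - h)) = 0"
    by (intro p_null_add p_null_mult g)
  then have "((1 - g) * z - 1) + z * (g - h) \<in> J"
    using null by (auto simp: null_ideal_def)
  then have "z * (1 - h) + - 1 * (((1 - g) * z - 1) + z * (g - h)) \<in> J"
    using J one_h by blast
  also have "z * (1 - h) + - 1 * (((1 - g) * z - 1) + z * (g - h)) = 1"
    by (simp add: algebra_simps)
  finally show False using maximalideal_one_notin[OF max] by simp
qed

text \<open>\<open>q\<close> is the quotient seminorm, the \<open>p \<alpha>\<close>-distance to
  \<open>J\<close>. \<open>maximalideal_dist_one\<close> makes it nonzero at \<open>1\<close>, and
  \<open>gelfand_mazur\<close> applies.\<close>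

lemma maximalideal_scalar:
  assumes max: "maximalideal J ring_of_type_algebra" and null: "null_ideal (p \<alpha>) \<subseteq> J"
  shows "\<exists>c. a - emb c \<in> J"
proof -
  define q where "q x = (INF j\<in>J. p \<alpha> (x - j))" for x
  have "ideal J ring_of_type_algebra"
    using max by (rule maximalideal.axioms(1))
  then have J: "0 \<in> J" "\<And>x y. x \<in> J \<Longrightarrow> y \<in> J \<Longrightarrow> x + y \<in> J" "\<And>r x. x \<in> J \<Longrightarrow> r * x \<in> J"
    by (auto simp: ideal_ring_of_type_algebra_iff)
  have bdd: "bdd_below ((\<lambda>j. p \<alpha> (x - j)) ` J)" for x
    using p_nonneg by (intro bdd_belowI[of _ 0]) auto
  have lower: "q x \<le> p \<alpha> (x - j)" if "j \<in> J" for x j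
    unfolding q_def using bdd that by (rule cINF_lower)
  have greatest: "c \<le> q x" if "\<And>j. j \<in> J \<Longrightarrow> c \<le> p \<alpha> (x - j)" for c x
    unfolding q_def using that J(1) by (intro cINF_greatest) auto
  \<comment> \<open>Multiplication by a nonnegative \<open>b\<close> commutes with the infimum. The
    argument divides by \<open>b\<close>, hence the separate case \<open>b = 0\<close>.\<close>
  have greatest_mult: "c \<le> b * q x" if "0 \<le> b" "0 \<le> c \<longrightarrow> (\<forall>j\<in>J. c \<le> b * p \<alpha> (x - j))" for b c x
  proof (cases "b = 0 \<or> c < 0")
    case False
    then have "c / b \<le> q x"
      using that by (intro greatest) (auto simp: field_simps)
    then show ?thesis using False that by (simp add: field_simps)
  next
    case True
    have "0 \<le> q x" by (intro greatest p_nonneg)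
    then have "0 \<le> b * q x" using that by simp
    then show ?thesis using True that J(1) by force
  qed
  interpret seminormed_residue_field emb J q
  proof
    show "emb 1 = 1" "\<And>c d. emb (c + d) = emb c + emb d" "\<And>c d. emb (c * d) = emb c * emb d"
      by (simp_all add: emb_add emb_mult)
    show "\<And>x y. x \<in> J \<Longrightarrow> y \<in> J \<Longrightarrow> x + y \<in> J" "\<And>x r. x \<in> J \<Longrightarrow> r * x \<in> J"
      by (fact J)+
    show "\<And>x. x \<notin> J \<Longrightarrow> \<exists>y. x * y - 1 \<in> J"
      by (rule maximalideal_inverse[OF max])
    show "q (x + y) \<le> q x + q y" for x y
    proof -
      have "q (x + y) - p \<alpha> (x - j) \<le> q y" if j: "j \<in> J" for j
      proof (rule greatest)
        fix k assume "k \<in> J"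
        then have "q (x + y) \<le> p \<alpha> (x + y - (j + k))" using lower J j by blast
        also have "x + y - (j + k) = (x - j) + (y - k)" by simp
        finally show "q (x + y) - p \<alpha> (x - j) \<le> p \<alpha> (y - k)"
          using p_add[of \<alpha> "x - j" "y - k"] by linarith
      qed
      then have "q (x + y) - q y \<le> q x" by (intro greatest) (simp add: algebra_simps)
      then show ?thesis by simp
    qed
    show "q (x * y) \<le> q x * q y" for x y
    proof -
      have "q (x * y) \<le> p \<alpha> (x - j) * q y" if j: "j \<in> J" for j
      proof (intro greatest_mult p_nonneg impI ballI)
        fix k assume k: "k \<in> J"
        \<comment> \<open>This correction in \<open>J\<close> turns \<open>x * y\<close> into the
          product of the representatives \<open>x - j\<close> and \<open>y - k\<close>.\<close>
        have "y * j + (x - j) * k \<in> J" using J j k by blast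
        then have "q (x * y) \<le> p \<alpha> (x * y - (y * j + (x - j) * k))" by (rule lower)
        also have "x * y - (y * j + (x - j) * k) = (x - j) * (y - k)" by (simp add: algebra_simps)
        finally show "q (x * y) \<le> p \<alpha> (x - j) * p \<alpha> (y - k)" using p_mult order_trans by blast
      qed
      then have "q (x * y) \<le> q y * q x"
        by (intro greatest_mult greatest p_nonneg) (simp add: mult.commute)
      then show ?thesis by (simp add: mult.commute)
    qed
    show "q (emb c * x) = cmod c * q x" for c x
    proof (rule antisym)
      show "q (emb c * x) \<le> cmod c * q x"
      proof (intro greatest_mult norm_ge_zero impI ballI)
        fix j assume "j \<in> J"
        then have "q (emb c * x) \<le> p \<alpha> (emb c * x - emb c * j)" by (intro lower J)
        then show "q (emb c * x) \<le> cmod c * p \<alpha> (x - j)"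
          by (simp add: right_diff_distrib[symmetric] p_emb_mult)
      qed
      show "cmod c * q x \<le> q (emb c * x)"
      proof (rule greatest)
        fix j assume j: "j \<in> J"
        show "cmod c * q x \<le> p \<alpha> (emb c * x - j)"
        proof (cases "c = 0")
          case False
          have "cmod c * q x \<le> cmod c * p \<alpha> (x - emb (1 / c) * j)"
            using j by (intro mult_left_mono lower J) auto
          also have "\<dots> = p \<alpha> (emb c * x - emb (c * (1 / c)) * j)"
            by (simp only: emb_mult p_emb_mult[symmetric] right_diff_distrib mult.assoc)
          finally show ?thesis using False by simp
        qed (simp add: p_nonneg)
      qed
    qed
    show "q x = 0" if "x \<in> J" for x
      using lower[OF that, of x] greatest[of 0 x] by (simp add: p_zero p_nonneg)
    show "q 1 \<le> 1"
      using lower[OF J(1), of 1] by (simp add: p_one)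
    show "0 < q 1"
      using greatest[of "1 / 64" 1] maximalideal_dist_one[OF max null] by simp
  qed
  show ?thesis by (rule gelfand_mazur)
qed

text \<open>\<open>\<chi> a\<close> is the scalar congruent to \<open>a\<close> modulo
  \<open>J\<close>. It is unique because a nonzero scalar in \<open>J\<close> would be a unit, and
  uniqueness turns the laws of a character into congruences.\<close>

lemma maximalideal_is_kernel:
  assumes max: "maximalideal J ring_of_type_algebra" and null: "null_ideal (p \<alpha>) \<subseteq> J"
  shows "\<exists>\<chi>. character_mod scaleC (null_ideal (p \<alpha>)) \<chi> \<and> J = {a. \<chi> a = 0}"
proof -
  have "ideal J ring_of_type_algebra"
    using max by (rule maximalideal.axioms(1))
  then have J: "0 \<in> J" "\<And>x y. x \<in> J \<Longrightarrow> y \<in> J \<Longrightarrow> x + y \<in> J" "\<And>r x. x \<in> J \<Longrightarrow> r * x \<in> J"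
    by (auto simp: ideal_ring_of_type_algebra_iff)
  obtain \<chi> where \<chi>: "a - emb (\<chi> a) \<in> J" for a
    using maximalideal_scalar[OF max null] by metis
  have unique: "\<chi> a = c" if "a - emb c \<in> J" for a c
  proof (rule ccontr)
    assume ne: "\<chi> a \<noteq> c"
    have "(a - emb c) + - 1 * (a - emb (\<chi> a)) \<in> J" by (intro J \<chi> that)
    also have "(a - emb c) + - 1 * (a - emb (\<chi> a)) = emb (\<chi> a - c)"
      by (simp add: emb_diff)
    finally have "emb (1 / (\<chi> a - c)) * emb (\<chi> a - c) \<in> J" by (rule J(3))
    then show False
      using ne maximalideal_one_notin[OF max] by (simp add: emb_mult[symmetric])
  qed
  have zero_iff: "\<chi> a = 0 \<longleftrightarrow> a \<in> J" for a
    using \<chi>[of a] unique[of a 0] by auto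
  have "\<chi> (a + b) = \<chi> a + \<chi> b" for a b
  proof (rule unique)
    have "(a - emb (\<chi> a)) + (b - emb (\<chi> b)) \<in> J" by (intro J \<chi>)
    then show "a + b - emb (\<chi> a + \<chi> b) \<in> J" by (simp add: emb_add algebra_simps)
  qed
  moreover have "\<chi> (scaleC c a) = c * \<chi> a" for c a
  proof (rule unique)
    have "emb c * (a - emb (\<chi> a)) \<in> J" by (intro J \<chi>)
    then show "scaleC c a - emb (c * \<chi> a) \<in> J"
      by (simp add: scale_emb emb_mult right_diff_distrib)
  qed
  moreover have "\<chi> (a * b) = \<chi> a * \<chi> b" for a b
  proof (rule unique)
    have "b * (a - emb (\<chi> a)) + emb (\<chi> a) * (b - emb (\<chi> b)) \<in> J" by (intro J \<chi>)
    then show "a * b - emb (\<chi> a * \<chi> b) \<in> J" by (simp add: emb_mult algebra_simps)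
  qed
  moreover have "\<chi> 1 \<noteq> 0"
    using zero_iff maximalideal_one_notin[OF max] by blast
  ultimately have "character_mod scaleC (null_ideal (p \<alpha>)) \<chi>"
    using null zero_iff unfolding character_mod_def by blast
  moreover have "J = {a. \<chi> a = 0}" using zero_iff by blast
  ultimately show ?thesis by blast
qed

end

theorem theorem2p10:
  fixes scaleC :: "complex \<Rightarrow> 'a::{comm_ring_1, uniform_space, t2_space} \<Rightarrow> 'a"
    and star :: "'a \<Rightarrow> 'a"
    and p :: "'i::order \<Rightarrow> 'a \<Rightarrow> real"
  assumes "locally_cstar_algebra scaleC star p"
  shows "bij_betw (\<lambda>\<chi>. {a. \<chi> a = 0})
           (character_space scaleC p)
           {J. maximalideal J (ring_of_type_algebra :: 'a ring) \<and>
               (\<exists>\<alpha>. null_ideal (p \<alpha>) \<subseteq> J)}"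
proof -
  interpret comm_locally_cstar_algebra scaleC star p
    using assms by (rule comm_locally_cstar_algebra.intro)
  show ?thesis
  proof (rule bij_betw_imageI[OF inj_on_kernel], intro equalityI subsetI)
    fix J assume "J \<in> (\<lambda>\<chi>. {a. \<chi> a = 0}) ` character_space scaleC p"
    then obtain \<alpha> \<chi> where "character_mod scaleC (null_ideal (p \<alpha>)) \<chi>" and J: "J = {a. \<chi> a = 0}"
      by (auto simp: character_space_iff)
    then have "maximalideal J ring_of_type_algebra" "null_ideal (p \<alpha>) \<subseteq> J"
      using maximalideal_kernel by (auto simp: character_mod_def)
    then show "J \<in> {J. maximalideal J ring_of_type_algebra \<and> (\<exists>\<alpha>. null_ideal (p \<alpha>) \<subseteq> J)}"
      by blast
  next
    fix J assume "J \<in> {J. maximalideal J ring_of_type_algebra \<and> (\<exists>\<alpha>. null_ideal (p \<alpha>) \<subseteq> J)}"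
    then show "J \<in> (\<lambda>\<chi>. {a. \<chi> a = 0}) ` character_space scaleC p"
      using maximalideal_is_kernel character_space_iff by blast
  qed
qed

end
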